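(* Let $d = \log 2/\log 3$. There is a constant $c_1 > 0$ such that for all real $T > 3$ we have $$\widetilde N^*(T) \geq \frac{T^d}{2} \qquad \text{and} \qquad N^*(T) \geq c_1 \log(T)\, T^d .$$
   Context: $\mathcal{C}$ denotes Cantor's middle thirds set, i.e. the set of all real numbers of the form $x = \sum_{i=1}^{\infty} a_i 3^{-i}$ with $a_i = a_i(x) \in \{0,2\}$ for all $i \ge 1$ (for $x\in\mathcal{C}$ the sequence $(a_i(x))_{i\ge1}$ with digits in $\{0,2\}$ is unique). A number $x \in \mathcal{C}$ is rational if and only if the sequence $(a_i(x))_{i\ge 1}$ is eventually periodic, i.e. there are integers $i_0 \ge 0$ and $\ell > 0$ with $a_i(x) = a_{i+\ell}(x)$ for all $i > i_0$; take $i_0=i_0(x)$ and $\ell=\ell(x)$ minimal. A rational $x \in \mathcal{C}$ is called purely periodic if $i_0(x) = 0$. When a rational is written $p/q$ it is assumed that $\gcd(p,q)=1$ and $q>0$. Define $$N^*(T) = \#\left\{ \tfrac{p}{q} \in \mathcal{C} : \gcd(p,q)=1,\ 0 < q \le T \right\},$$ $$\widetilde N^*(T) = \#\left\{ \tfrac{p}{q} \in \mathcal{C} : \gcd(p,q)=1,\ 0 < q \le T,\ \tfrac{p}{q} \text{ is purely periodic} \right\}.$$ *)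

theory Defs
  imports Complex_Main
begin

text \<open>Digit sequences are indexed from 1; the value of \<open>a\<close> at index 0 is irrelevant.\<close>

definition cantor_expansion :: "(nat \<Rightarrow> nat) \<Rightarrow> real \<Rightarrow> bool" where
  "cantor_expansion a x \<longleftrightarrow>
     (\<forall>i\<ge>1. a i \<in> {0, 2}) \<and> (\<lambda>n. real (a (Suc n)) / 3 ^ Suc n) sums x"

definition cantor_set :: "real set" where
  "cantor_set = {x. \<exists>a. cantor_expansion a x}"

text \<open>
  The description is proper for \<open>x\<close> in the Cantor set and \<open>i \<ge> 1\<close>, by uniqueness of the
  expansion with digits 0 and 2. Other arguments are never used.
\<close>

definition cantor_digit :: "real \<Rightarrow> nat \<Rightarrow> nat" where
  "cantor_digit x i = (THE k. \<exists>a. cantor_expansion a x \<and> a i = k)"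

text \<open>
  The minimal \<open>i\<^sub>0\<close>. It exists exactly when the digit sequence is eventually periodic,
  that is (for \<open>x\<close> in the Cantor set) when \<open>x\<close> is rational.
\<close>

definition preperiod :: "real \<Rightarrow> nat" where
  "preperiod x =
     (LEAST i0. \<exists>l>0. \<forall>i>i0. cantor_digit x i = cantor_digit x (i + l))"

definition purely_periodic :: "real \<Rightarrow> bool" where
  "purely_periodic x \<longleftrightarrow> x \<in> cantor_set \<and> x \<in> \<rat> \<and> preperiod x = 0"

text \<open>
  The sets counted below are finite, since the Cantor set lies in the unit interval, so
  \<^const>\<open>card\<close> is the true number of elements.
\<close>

definition N_star :: "real \<Rightarrow> nat" where
  "N_star T = card {x \<in> cantor_set.
     \<exists>p q :: int. x = of_int p / of_int q \<and> coprime p q \<and> 0 < q \<and> of_int q \<le> T}"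

definition N_star_pure :: "real \<Rightarrow> nat" where
  "N_star_pure T = card {x \<in> cantor_set.
     (\<exists>p q :: int. x = of_int p / of_int q \<and> coprime p q \<and> 0 < q \<and> of_int q \<le> T) \<and>
     purely_periodic x}"

end

theory Submission
  imports Defs
begin

text \<open>
  Choose \<open>n\<close> with \<open>3\<^sup>n \<le> T < 3\<^sup>n\<^sup>+\<^sup>1\<close>, so that \<open>2\<^sup>n > T\<^sup>d / 2\<close>. Fix \<open>j < n\<close> and take any word
  of length \<open>n\<close> over \<open>{0, 2}\<close>. Keep its first \<open>j\<close> letters as a preperiod and repeat the other
  \<open>n - j\<close> letters for ever. If \<open>x\<close> is the point of the Cantor set with these digits, then
  \<open>3\<^sup>n x\<close> and \<open>3\<^sup>j x\<close> have the same digits after the ternary point, hence \<open>(3\<^sup>n - 3\<^sup>j) x\<close> is an integer and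
  the reduced denominator of \<open>x\<close> is at most \<open>3\<^sup>n \<le> T\<close>
  (\<open>integer_multiple_if_periodic\<close>, \<open>bounded_denominator_if_multiple_int\<close>).

  For \<open>j = 0\<close> all \<open>2\<^sup>n\<close> words give different purely periodic points, which is the first bound.
  For \<open>j > 0\<close> the preperiod is exactly \<open>j\<close> as soon as the letters at positions \<open>j\<close> and \<open>n\<close>
  differ (\<open>preperiod_eqI\<close>), and this holds for half of the words. Points with different
  preperiods are different, so no further argument is needed to rule out that a point is
  counted for several \<open>j\<close>: in total there are at least \<open>2\<^sup>n + (n - 1) 2\<^sup>n\<^sup>-\<^sup>1 = (n + 1) 2\<^sup>n\<^sup>-\<^sup>1\<close>
  points. As \<open>ln T < (n + 1) ln 3\<close>, the second bound holds with \<open>c\<^sub>1 = 1 / (4 ln 3)\<close>.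
\<close>

section \<open>Ternary expansions with digits 0 and 2\<close>

lemma cantor_expansion_exists:
  assumes "\<forall>i\<ge>1. a i \<in> {0, 2}"
  shows "\<exists>x. cantor_expansion a x"
proof -
  have "summable (\<lambda>n. (2/3) * (1/3::real) ^ n)"
    by (intro summable_mult summable_geometric) simp
  moreover have "norm (real (a (Suc n)) / 3 ^ Suc n) \<le> (2/3) * (1/3) ^ n" for n
    using assms[rule_format, of "Suc n"] by (auto simp: power_one_over)
  ultimately have "summable (\<lambda>n. real (a (Suc n)) / 3 ^ Suc n)"
    by (rule summable_comparison_test'[where N = 0])
  then show ?thesis
    using assms unfolding cantor_expansion_def by (auto dest: summable_sums)
qed

lemma cantor_expansion_unique_value:
  assumes "cantor_expansion a x" "cantor_expansion b y" "\<And>i. i \<ge> 1 \<Longrightarrow> a i = b i"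
  shows "x = y"
  using assms sums_unique2 unfolding cantor_expansion_def by fastforce

lemma cantor_expansion_bounds:
  assumes "cantor_expansion a x"
  shows "0 \<le> x" "x \<le> 1"
proof -
  have s: "(\<lambda>n. real (a (Suc n)) / 3 ^ Suc n) sums x"
    and d: "a (Suc n) \<in> {0, 2}" for n
    using assms by (auto simp: cantor_expansion_def)
  show "0 \<le> x"
    by (rule sums_le[OF _ sums_zero s]) auto
  have g: "(\<lambda>n. (2/3) * (1/3::real) ^ n) sums ((2/3) * (1 / (1 - 1/3)))"
    by (intro sums_mult geometric_sums) simp
  have "real (a (Suc n)) / 3 ^ Suc n \<le> (2/3) * (1/3) ^ n" for n
    using d[of n] by (auto simp: power_one_over)
  from sums_le[OF this s g] show "x \<le> 1" by simp
qed

lemma cantor_expansion_shift: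
  assumes "cantor_expansion a x"
  shows "cantor_expansion (\<lambda>i. a (Suc i)) (3 * x - real (a 1))"
proof -
  have "(\<lambda>n. real (a (Suc n)) / 3 ^ Suc n) sums x"
    using assms by (simp add: cantor_expansion_def)
  then have "(\<lambda>n. real (a (Suc (Suc n))) / 3 ^ Suc (Suc n)) sums (x - real (a 1) / 3)"
    by (subst sums_Suc_iff) simp
  from sums_mult[OF this, of 3]
  have "(\<lambda>n. 3 * (real (a (Suc (Suc n))) / 3 ^ Suc (Suc n))) sums (3 * (x - real (a 1) / 3))" .
  moreover have "3 * (x - real (a 1) / 3) = 3 * x - real (a 1)" by simp
  moreover have "3 * (real (a (Suc (Suc n))) / 3 ^ Suc (Suc n)) = real (a (Suc (Suc n))) / 3 ^ Suc n"
    for n by simp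
  ultimately have "(\<lambda>n. real (a (Suc (Suc n))) / 3 ^ Suc n) sums (3 * x - real (a 1))"
    by (simp only:)
  then show ?thesis
    using assms by (simp add: cantor_expansion_def)
qed

lemma cantor_expansion_shift_many:
  assumes "cantor_expansion a x"
  shows "\<exists>B :: int. cantor_expansion (\<lambda>i. a (i + m)) (3 ^ m * x - of_int B)"
proof (induction m)
  case 0
  have "cantor_expansion (\<lambda>i. a (i + 0)) (3 ^ 0 * x - of_int 0)" using assms by simp
  then show ?case by blast
next
  case (Suc m)
  then obtain B :: int where "cantor_expansion (\<lambda>i. a (i + m)) (3 ^ m * x - of_int B)" by blast
  from cantor_expansion_shift[OF this]
  have "cantor_expansion (\<lambda>i. a (i + Suc m)) (3 ^ Suc m * x - of_int (3 * B + int (a (Suc m))))"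
    by (simp add: algebra_simps)
  then show ?case by blast
qed

text \<open>
  The first digit can be read off from the value, which lies in \<open>[0, 1/3]\<close> or in \<open>[2/3, 1]\<close>;
  shifting then reaches every other digit.
\<close>

lemma cantor_expansion_unique_digit:
  assumes "cantor_expansion a x" "cantor_expansion b x"
  shows "a (Suc i) = b (Suc i)"
proof -
  have first: "a 1 = b 1" if a: "cantor_expansion a x" and b: "cantor_expansion b x" for a b x
  proof -
    have "a 1 \<in> {0, 2}" "b 1 \<in> {0, 2}"
      using a b by (auto simp: cantor_expansion_def)
    then show ?thesis
      using cantor_expansion_bounds[OF cantor_expansion_shift[OF a]]
        cantor_expansion_bounds[OF cantor_expansion_shift[OF b]] by auto
  qed
  show ?thesis
    using assms
  proof (induction i arbitrary: a b x)
    case 0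
    then show ?case using first by fastforce
  next
    case (Suc i)
    have "cantor_expansion (\<lambda>i. b (Suc i)) (3 * x - real (a 1))"
      using cantor_expansion_shift[OF Suc.prems(2)] by (simp only: first[OF Suc.prems])
    then show ?case
      by (rule Suc.IH[OF cantor_expansion_shift[OF Suc.prems(1)]])
  qed
qed

lemma cantor_digit_eq:
  assumes "cantor_expansion a x" "i \<ge> 1"
  shows "cantor_digit x i = a i"
  unfolding cantor_digit_def
proof (rule the_equality)
  show "\<exists>b. cantor_expansion b x \<and> b i = a i" using assms(1) by blast
next
  fix m assume "\<exists>b. cantor_expansion b x \<and> b i = m"
  then obtain b where "cantor_expansion b x" "b i = m" by blast
  then show "m = a i"
    using cantor_expansion_unique_digit[OF _ assms(1), of b "i - 1"] assms(2) by simp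
qed

section \<open>Periodic expansions\<close>

text \<open>
  The tails after positions \<open>j\<close> and \<open>j + k\<close> coincide, and they are the values of
  \<open>3\<^sup>j x\<close> and \<open>3\<^sup>j\<^sup>+\<^sup>k x\<close> modulo 1.
\<close>

lemma integer_multiple_if_periodic:
  assumes x: "cantor_expansion a x" and per: "\<And>i. i > j \<Longrightarrow> a (i + k) = a i"
  shows "(3 ^ (j + k) - 3 ^ j) * x \<in> \<int>"
proof -
  obtain A where A: "cantor_expansion (\<lambda>i. a (i + j)) (3 ^ j * x - of_int A)"
    using cantor_expansion_shift_many[OF x] by blast
  obtain B where B: "cantor_expansion (\<lambda>i. a (i + (j + k))) (3 ^ (j + k) * x - of_int B)"
    using cantor_expansion_shift_many[OF x] by blast
  have "3 ^ j * x - of_int A = 3 ^ (j + k) * x - of_int B"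
  proof (rule cantor_expansion_unique_value[OF A B])
    fix i :: nat assume "i \<ge> 1"
    then show "a (i + j) = a (i + (j + k))"
      using per[of "i + j"] by (simp add: add.assoc)
  qed
  then have "(3 ^ (j + k) - 3 ^ j) * x = of_int (B - A)"
    by (simp add: algebra_simps)
  then show ?thesis by simp
qed

lemma bounded_denominator_if_multiple_int:
  fixes M :: int and x :: real
  assumes "0 < M" "of_int M * x \<in> \<int>"
  shows "\<exists>p q :: int. x = of_int p / of_int q \<and> coprime p q \<and> 0 < q \<and> q \<le> M"
proof -
  obtain m :: int where m: "of_int M * x = of_int m" using assms(2) by (rule Ints_cases)
  define g where "g = gcd m M"
  have g: "g > 0" using assms(1) by (simp add: g_def)
  obtain p q where pq: "m = p * g" "M = q * g" and "coprime p q"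
    using gcd_coprime_exists[of m M] g unfolding g_def by (metis less_irrefl)
  moreover have q: "0 < q" using pq g assms(1) by (simp add: zero_less_mult_iff)
  moreover have "q \<le> M" using pq(2) g q by simp
  moreover have "x = of_int p / of_int q"
    using m pq g q by (simp add: field_simps)
  ultimately show ?thesis by blast
qed

text \<open>
  If the digits were periodic after some \<open>i\<^sub>0 < j\<close> with period \<open>l\<close>, then the digits at
  \<open>j\<close> and \<open>j + k l\<close> would agree. The latter agrees with the digit at \<open>j + k\<close>, by going back in
  steps of \<open>k\<close>, and so a change of digit from \<open>j\<close> to \<open>j + k\<close> excludes this.
\<close>

lemma preperiod_eqI:
  assumes x: "cantor_expansion a x" and k: "k > 0"
    and per: "\<And>i. i > j \<Longrightarrow> a (i + k) = a i"
    and exact: "j = 0 \<or> a j \<noteq> a (j + k)"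
  shows "preperiod x = j"
  unfolding preperiod_def
proof (rule Least_equality)
  have "\<forall>i>j. cantor_digit x i = cantor_digit x (i + k)"
    using per by (simp add: cantor_digit_eq[OF x])
  then show "\<exists>l>0. \<forall>i>j. cantor_digit x i = cantor_digit x (i + l)"
    using k by blast
next
  fix i0 assume "\<exists>l>0. \<forall>i>i0. cantor_digit x i = cantor_digit x (i + l)"
  then obtain l where l: "l > 0"
    and per0: "\<forall>i>i0. cantor_digit x i = cantor_digit x (i + l)" by blast
  then have per': "a (i + l) = a i" if "i > i0" for i
  proof -
    have "cantor_digit x i = cantor_digit x (i + l)" using per0 that by blast
    then show ?thesis using cantor_digit_eq[OF x] that by simp
  qed
  show "j \<le> i0"
  proof (rule ccontr)
    assume "\<not> j \<le> i0"
    then have j: "i0 < j" by simp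
    have "a (j + m * l) = a j" for m
    proof (induction m)
      case (Suc m)
      then show ?case using per'[of "j + m * l"] j by (simp add: algebra_simps)
    qed simp
    moreover have "a (j + k + m * k) = a (j + k)" for m
    proof (induction m)
      case (Suc m)
      then show ?case using per[of "j + k + m * k"] k by (simp add: algebra_simps)
    qed simp
    from this[of "l - 1"] have "a (j + k * l) = a (j + k)"
      using l by (cases l) (simp_all add: algebra_simps)
    ultimately have "a j = a (j + k)" by metis
    then show False using exact j by simp
  qed
qed

section \<open>Points from finite words\<close>

text \<open>
  A word of length \<open>n\<close> is given by the set \<open>S \<subseteq> {1..n}\<close> of the positions that carry the digit 2.
  A position after the preperiod \<open>j\<close> is reduced to the block \<open>{j+1..n}\<close>.
\<close>

definition word_digits :: "nat \<Rightarrow> nat \<Rightarrow> nat set \<Rightarrow> nat \<Rightarrow> nat" where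
  "word_digits n j S i =
     (if (if i \<le> j then i else Suc j + (i - Suc j) mod (n - j)) \<in> S then 2 else 0)"

definition word_point :: "nat \<Rightarrow> nat \<Rightarrow> nat set \<Rightarrow> real" where
  "word_point n j S = (SOME x. cantor_expansion (word_digits n j S) x)"

lemma word_digits_within:
  "j < n \<Longrightarrow> i \<le> n \<Longrightarrow> word_digits n j S i = (if i \<in> S then 2 else 0)"
  by (auto simp: word_digits_def)

lemma word_digits_periodic:
  assumes "j < n" "i > j"
  shows "word_digits n j S (i + (n - j)) = word_digits n j S i"
proof -
  have "i + (n - j) - Suc j = (i - Suc j) + (n - j)" using assms by simp
  then have "(i + (n - j) - Suc j) mod (n - j) = (i - Suc j) mod (n - j)" by simp
  moreover have "\<not> i + (n - j) \<le> j" "\<not> i \<le> j" using assms by simp_all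
  ultimately show ?thesis by (simp only: word_digits_def if_False)
qed

lemma word_point_expansion: "cantor_expansion (word_digits n j S) (word_point n j S)"
  unfolding word_point_def
  by (rule someI_ex, rule cantor_expansion_exists) (simp add: word_digits_def)

lemma inj_on_word_point:
  assumes "j < n"
  shows "inj_on (word_point n j) (Pow {1..n})"
proof (rule inj_onI)
  fix S S' assume S: "S \<in> Pow {1..n}" "S' \<in> Pow {1..n}"
    and eq: "word_point n j S = word_point n j S'"
  have "i \<in> S \<longleftrightarrow> i \<in> S'" if i: "i \<in> {1..n}" for i
  proof -
    have "word_digits n j S i = word_digits n j S' i"
      using cantor_digit_eq[OF word_point_expansion[of n j S], of i]
        cantor_digit_eq[OF word_point_expansion[of n j S'], of i] eq i by simp
    then show ?thesis
      using i assms by (simp add: word_digits_within split: if_splits)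
  qed
  then show "S = S'" using S by blast
qed

lemma word_point_denominator:
  assumes "j < n"
  shows "\<exists>p q :: int. word_point n j S = of_int p / of_int q \<and> coprime p q \<and> 0 < q \<and> q \<le> 3 ^ n"
proof -
  have "(3 ^ (j + (n - j)) - 3 ^ j) * word_point n j S \<in> \<int>"
    using word_point_expansion word_digits_periodic[OF assms] by (rule integer_multiple_if_periodic)
  then have "of_int (3 ^ n - 3 ^ j) * word_point n j S \<in> \<int>"
    using assms by simp
  moreover have "(3::int) ^ n - 3 ^ j > 0" using assms by simp
  ultimately obtain p q :: int where
    "word_point n j S = of_int p / of_int q \<and> coprime p q \<and> 0 < q \<and> q \<le> 3 ^ n - 3 ^ j"
    using bounded_denominator_if_multiple_int by blast
  moreover have "(3::int) ^ j > 0" by simp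
  ultimately show ?thesis by (smt (verit))
qed

section \<open>Counting\<close>

text \<open>
  The last letter before the repeated block must differ from the last letter of the block:
  otherwise the repetition could start one position earlier.
\<close>

definition exact_words :: "nat \<Rightarrow> nat \<Rightarrow> nat set set" where
  "exact_words n j = {S \<in> Pow {1..n}. j = 0 \<or> (j \<in> S \<longleftrightarrow> n \<notin> S)}"

lemma preperiod_word_point:
  assumes "j < n" "S \<in> exact_words n j"
  shows "preperiod (word_point n j S) = j"
proof (rule preperiod_eqI[OF word_point_expansion])
  show "0 < n - j" using assms by simp
  show "j = 0 \<or> word_digits n j S j \<noteq> word_digits n j S (j + (n - j))"
    using assms by (auto simp: word_digits_within exact_words_def)
qed (use word_digits_periodic[OF assms(1)] in blast)

lemma card_exact_words:
  assumes "0 < j" "j < n"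
  shows "card (exact_words n j) \<ge> 2 ^ (n - 1)"
proof -
  \<comment> \<open>The first \<open>n - 1\<close> letters are free, and the letter at \<open>j\<close> determines the last one.\<close>
  let ?f = "\<lambda>S. if j \<in> S then S else insert n S"
  have "inj_on ?f (Pow {1..<n})"
    using assms by (intro inj_on_inverseI[where g = "\<lambda>S. S - {n}"]) auto
  moreover have "?f ` Pow {1..<n} \<subseteq> exact_words n j"
    using assms by (auto simp: exact_words_def)
  moreover have "finite (exact_words n j)"
    by (rule finite_subset[of _ "Pow {1..n}"]) (auto simp: exact_words_def)
  ultimately have "card (Pow {1..<n}) \<le> card (exact_words n j)"
    by (intro card_inj_on_le)
  then show ?thesis by (simp add: card_Pow)
qed

lemma card_word_points_exact:
  assumes "j < n"
  shows "card (word_point n j ` exact_words n j) = card (exact_words n j)"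
  by (intro card_image inj_on_subset[OF inj_on_word_point[OF assms]]) (auto simp: exact_words_def)

lemma card_word_points_pure:
  assumes "0 < n"
  shows "card (word_point n 0 ` exact_words n 0) = 2 ^ n"
proof -
  have "exact_words n 0 = Pow {1..n}" by (auto simp: exact_words_def)
  then show ?thesis using card_word_points_exact[OF assms] by (simp add: card_Pow)
qed

lemma card_word_points:
  assumes "0 < n"
  shows "card (\<Union>j<n. word_point n j ` exact_words n j) \<ge> (n + 1) * 2 ^ (n - 1)"
proof -
  have fin: "finite (exact_words n j)" for j
    by (rule finite_subset[of _ "Pow {1..n}"]) (auto simp: exact_words_def)
  have "(n + 1) * 2 ^ (n - 1) = 2 ^ n + (\<Sum>j\<in>{1..<n}. 2 ^ (n - 1) :: nat)"
    using assms by (cases n) (simp_all add: algebra_simps)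
  also have "\<dots> \<le> card (word_point n 0 ` exact_words n 0)
      + (\<Sum>j\<in>{1..<n}. card (word_point n j ` exact_words n j))"
    using card_exact_words card_word_points_exact card_word_points_pure[OF assms]
    by (intro add_mono sum_mono) auto
  also have "\<dots> = (\<Sum>j<n. card (word_point n j ` exact_words n j))"
    using assms by (simp add: lessThan_atLeast0 sum.atLeast_Suc_lessThan)
  also have "\<dots> = card (\<Union>j<n. word_point n j ` exact_words n j)"
  proof (rule card_UN_disjoint[symmetric])
    have "i = j" if "i < n" "j < n" "x \<in> word_point n i ` exact_words n i"
      "x \<in> word_point n j ` exact_words n j" for i j x
    proof -
      have "preperiod x = i" using that preperiod_word_point by auto
      moreover have "preperiod x = j" using that preperiod_word_point by auto
      ultimately show ?thesis by simp
    qed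
    then show "\<forall>i\<in>{..<n}. \<forall>j\<in>{..<n}. i \<noteq> j \<longrightarrow>
        word_point n i ` exact_words n i \<inter> word_point n j ` exact_words n j = {}"
      by blast
  qed (use fin in auto)
  finally show ?thesis .
qed

lemma finite_bounded_denominator:
  "finite {x \<in> cantor_set.
     \<exists>p q :: int. x = of_int p / of_int q \<and> coprime p q \<and> 0 < q \<and> of_int q \<le> (T :: real)}"
proof (rule finite_subset)
  let ?I = "{0..\<lfloor>T\<rfloor>}"
  show "{x \<in> cantor_set.
     \<exists>p q :: int. x = of_int p / of_int q \<and> coprime p q \<and> 0 < q \<and> of_int q \<le> T}
     \<subseteq> (\<lambda>(p, q). of_int p / of_int q) ` (?I \<times> ?I)"
  proof (clarify)
    fix p q :: int
    assume c: "(of_int p :: real) / of_int q \<in> cantor_set" and q: "0 < q" "of_int q \<le> T"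
    have "0 \<le> (of_int p :: real) / of_int q" "(of_int p :: real) / of_int q \<le> 1"
      using c cantor_expansion_bounds by (auto simp: cantor_set_def)
    then have "0 \<le> p" "p \<le> q" using q(1) by (simp_all add: field_simps)
    then have "(p, q) \<in> ?I \<times> ?I" using q by (auto simp: le_floor_iff)
    then show "(of_int p :: real) / of_int q \<in> (\<lambda>(p, q). of_int p / of_int q) ` (?I \<times> ?I)"
      by force
  qed
qed simp

lemma word_points_counted:
  fixes T :: real
  assumes "3 ^ n \<le> T"
  shows "(\<Union>j<n. word_point n j ` exact_words n j) \<subseteq> {x \<in> cantor_set.
     \<exists>p q :: int. x = of_int p / of_int q \<and> coprime p q \<and> 0 < q \<and> of_int q \<le> T}"
proof clarify
  fix j S assume "j < n"
  then obtain p q :: int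
    where pq: "word_point n j S = of_int p / of_int q" "coprime p q" "0 < q" "q \<le> 3 ^ n"
    using word_point_denominator by blast
  have "(of_int q :: real) \<le> 3 ^ n"
    using pq(4) by (metis of_int_le_iff of_int_numeral of_int_power)
  then have "of_int q \<le> T" using assms by linarith
  moreover have "word_point n j S \<in> cantor_set"
    using word_point_expansion by (auto simp: cantor_set_def)
  ultimately show "word_point n j S \<in> cantor_set \<and> (\<exists>p q :: int.
      word_point n j S = of_int p / of_int q \<and> coprime p q \<and> 0 < q \<and> of_int q \<le> T)"
    using pq by blast
qed

lemma N_star_pure_ge:
  assumes "0 < n" "3 ^ n \<le> T"
  shows "N_star_pure T \<ge> 2 ^ n"
proof -
  have sub: "word_point n 0 ` exact_words n 0 \<subseteq> {x \<in> cantor_set.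
     (\<exists>p q :: int. x = of_int p / of_int q \<and> coprime p q \<and> 0 < q \<and> of_int q \<le> T)}"
    using word_points_counted[OF assms(2)] assms(1) by blast
  have "word_point n 0 ` exact_words n 0 \<subseteq> {x \<in> cantor_set.
     (\<exists>p q :: int. x = of_int p / of_int q \<and> coprime p q \<and> 0 < q \<and> of_int q \<le> T) \<and>
     purely_periodic x}"
  proof
    fix x assume x: "x \<in> word_point n 0 ` exact_words n 0"
    then have c: "x \<in> {x \<in> cantor_set.
     (\<exists>p q :: int. x = of_int p / of_int q \<and> coprime p q \<and> 0 < q \<and> of_int q \<le> T)}"
      using sub by blast
    then have "x \<in> \<rat>" by auto
    moreover have "preperiod x = 0" using x preperiod_word_point[OF assms(1)] by auto
    ultimately show "x \<in> {x \<in> cantor_set.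
     (\<exists>p q :: int. x = of_int p / of_int q \<and> coprime p q \<and> 0 < q \<and> of_int q \<le> T) \<and>
     purely_periodic x}" using c by (simp add: purely_periodic_def)
  qed
  then have "card (word_point n 0 ` exact_words n 0) \<le> N_star_pure T"
    unfolding N_star_pure_def
    by (intro card_mono finite_subset[OF _ finite_bounded_denominator[of T]]) auto
  then show ?thesis using card_word_points_pure[OF assms(1)] by simp
qed

lemma N_star_ge:
  assumes "0 < n" "3 ^ n \<le> T"
  shows "N_star T \<ge> (n + 1) * 2 ^ (n - 1)"
proof -
  have "card (\<Union>j<n. word_point n j ` exact_words n j) \<le> N_star T"
    unfolding N_star_def
    by (rule card_mono[OF finite_bounded_denominator word_points_counted[OF assms(2)]])
  then show ?thesis using card_word_points[OF assms(1)] by linarith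
qed

theorem proposition3p3:
  fixes d :: real
  assumes "d = ln 2 / ln 3"
  shows "\<exists>c\<^sub>1 > 0. \<forall>T :: real. T > 3 \<longrightarrow>
           real (N_star_pure T) \<ge> T powr d / 2 \<and>
           real (N_star T) \<ge> c\<^sub>1 * ln T * T powr d"
proof (intro exI[of _ "1 / (4 * ln 3)"] conjI allI impI)
  show "0 < 1 / (4 * ln (3::real))" by simp
  fix T :: real assume T: "T > 3"
  define n where "n = nat \<lfloor>log 3 T\<rfloor>"
  have "log 3 T \<ge> 1" using T by simp
  then have n: "n \<ge> 1" and n_le: "real n \<le> log 3 T" and lt_n: "log 3 T < real n + 1"
    unfolding n_def by linarith+
  have lo: "3 ^ n \<le> T"
    using n_le T by (simp add: le_log_iff powr_realpow)
  have hi: "ln T < (real n + 1) * ln 3"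
    using lt_n by (simp add: log_def field_simps)
  have "T powr d = exp (ln T * ln 2 / ln 3)"
    using T assms by (simp add: powr_def)
  also have "\<dots> \<le> exp (real (n + 1) * ln 2)"
    using mult_right_mono[of "ln T" "(real n + 1) * ln 3" "ln 2"] hi by (simp add: field_simps)
  also have "\<dots> = 2 ^ (n + 1)"
    by (metis exp_ln exp_of_nat_mult zero_less_numeral)
  finally have pow: "T powr d \<le> 2 ^ (n + 1)" .
  have "real (2 ^ n) \<le> real (N_star_pure T)"
    using N_star_pure_ge[OF _ lo] n by (simp only: of_nat_le_iff)
  moreover have "T powr d / 2 \<le> real (2 ^ n)" using pow by simp
  ultimately show "real (N_star_pure T) \<ge> T powr d / 2" by linarith
  have "1 / (4 * ln 3) * ln T * T powr d \<le> 1 / (4 * ln 3) * ((real n + 1) * ln 3) * 2 ^ (n + 1)"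
    using hi pow T by (intro mult_mono) auto
  also have "\<dots> = real ((n + 1) * 2 ^ (n - 1))"
    using n by (cases n) (simp_all add: field_simps)
  also have "\<dots> \<le> real (N_star T)"
    using N_star_ge[OF _ lo] n by (simp only: of_nat_le_iff)
  finally show "real (N_star T) \<ge> 1 / (4 * ln 3) * ln T * T powr d" .
qed

end
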